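(* Let $d\ge 1$ and let $X$ and $X_{\mathbf n}$, $\mathbf n\in\mathbb Z_+^d$, be real-valued random variables on a probability space $(\Omega,\mathcal F,P)$ (no assumption is made on their dependence). Assume there is a constant $M>0$ such that $$\frac{1}{|\mathbf n|}\sum_{\mathbf k\preceq \mathbf n}P(|X_{\mathbf k}|>x)\le M\,P(|X|>x)\qquad\text{for all } x\ge 0 \text{ and all } \mathbf n\in\mathbb Z_+^d .$$ Let $1<p<2$ and assume $E|X|^p<\infty$. For a positive integer $n$ write $N=(n,\dots,n)\in\mathbb Z_+^d$, so $|N|=n^d$. Then for almost all $t\in\mathbb T^d$ (with respect to Lebesgue measure), $$\lim_{n\to\infty}\frac{S_{N}(t)}{|N|^{1/p}}=0\qquad P\text{-almost surely}.$$
   Context: $\mathbb Z_+^d$ is the set of $d$-dimensional lattice points with positive integer coordinates. For $\mathbf k,\mathbf n\in\mathbb Z_+^d$, $\mathbf k\preceq\mathbf n$ means $k_i\le n_i$ for all $1\le i\le d$, and $|\mathbf n|=n_1n_2\cdots n_d$. $\mathbb T=[-\pi,\pi)$. For $t=(t_1,\dots,t_d)\in\mathbb T^d$, $\mathbf k\cdot t=k_1t_1+\cdots+k_dt_d$, and the discrete Fourier transform is $S_{\mathbf n}(t)=\sum_{\mathbf k\preceq\mathbf n}e^{i\mathbf k\cdot t}X_{\mathbf k}$. *)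

theory Defs
  imports "HOL-Probability.Probability"
begin

text \<open>
  The dimension \<open>d\<close> is \<open>CARD('d)\<close> for a finite index type \<open>'d\<close>. The order \<open>\<preceq>\<close> is the
  componentwise order \<open>\<le>\<close> of the library on \<open>nat ^ 'd\<close>.
\<close>

definition pos_lattice :: "(nat ^ 'd) set" where
  "pos_lattice = {n. \<forall>i. 0 < n $ i}"

definition lattice_vol :: "nat ^ 'd \<Rightarrow> nat" where
  "lattice_vol n = (\<Prod>i\<in>UNIV. n $ i)"

definition lattice_dot :: "nat ^ 'd \<Rightarrow> real ^ 'd \<Rightarrow> real" where
  "lattice_dot k t = (\<Sum>i\<in>UNIV. real (k $ i) * t $ i)"

definition torus :: "(real ^ 'd) set" where
  "torus = {t. \<forall>i. - pi \<le> t $ i \<and> t $ i < pi}"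

definition dft :: "(nat ^ 'd \<Rightarrow> 'a \<Rightarrow> real) \<Rightarrow> nat ^ 'd \<Rightarrow> real ^ 'd \<Rightarrow> 'a \<Rightarrow> complex" where
  "dft X n t \<omega> =
     (\<Sum>k\<in>{k \<in> pos_lattice. k \<le> n}. exp (\<i> * of_real (lattice_dot k t)) * of_real (X k \<omega>))"

end

theory Submission
  imports Defs "HOL-Real_Asymp.Real_Asymp"
begin

text \<open>
  For a fixed \<open>\<omega>\<close> put \<open>x k = X k \<omega>\<close>. Ordered by their maximal coordinate, the characters
  \<open>exp (\<i> k \<cdot> t)\<close> form an orthogonal sequence on the torus, so the Rademacher-Menshov inequality
  bounds maximal partial sums up to the factor \<open>(1 + log N)\<^sup>2\<close>, where \<open>N\<close> counts only the
  nonzero coefficients. Consider \<open>n \<le> 2\<^sup>m\<close>, put \<open>a = (2\<^sup>m)\<^sup>d\<^sup>/\<^sup>p\<close>, and split the coefficients into the layers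
  \<open>a / 2\<^sup>i < \<bar>x k\<bar> \<le> 2 a / 2\<^sup>i\<close>. Almost surely, for all large \<open>m\<close>, the \<open>i\<close>-th layer has at most
  \<open>4\<^sup>i\<close> elements, and \<open>\<bar>x k\<bar> \<le> a\<close> for all \<open>k\<close>; so the logarithm costs only a polynomial in \<open>i\<close>.
  As \<open>p < 2\<close>, the expected squares of the layers decay geometrically in \<open>i\<close>, and they are summable
  over \<open>m\<close> by the moment assumption. This avoids Carleson's theorem.
  Finally, Fubini exchanges the two almost-everywhere quantifiers.
\<close>

section \<open>The Rademacher-Menshov maximal inequality\<close>

text \<open>Young's inequality, from expanding \<open>(s * a - b)\<^sup>2 / s\<close>. The weights
  are chosen so that one bisection step raises a constant \<open>s\<^sup>2\<close> to exactly
  \<open>(s + 1)\<^sup>2\<close>.\<close>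

lemma power2_sum_le_weighted:
  fixes a b s :: real
  assumes "0 < s"
  shows "(a + b)\<^sup>2 \<le> (s + 1) * a\<^sup>2 + (s + 1) / s * b\<^sup>2"
proof -
  have "0 \<le> (s * a - b)\<^sup>2 / s"
    using assms by simp
  also have "\<dots> = (s + 1) * a\<^sup>2 + (s + 1) / s * b\<^sup>2 - (a + b)\<^sup>2"
    using assms by (simp add: field_simps power2_eq_square)
  finally show ?thesis by simp
qed

text \<open>
  Bisection: a partial sum is bounded by a partial sum of the left half, or by the full
  left half plus a partial sum of the right half.
\<close>

lemma rademacher_menshov_list:
  fixes f :: "'k \<Rightarrow> 't \<Rightarrow> complex" and c :: "'k \<Rightarrow> real"
  assumes "distinct xs" and "length xs \<le> 2 ^ r"
    and meas: "\<And>k. k \<in> set xs \<Longrightarrow> f k \<in> borel_measurable \<mu>"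
    and c: "\<And>k. k \<in> set xs \<Longrightarrow> 0 \<le> c k"
    and orth: "\<And>B. B \<subseteq> set xs \<Longrightarrow>
      (\<integral>\<^sup>+t. ennreal ((cmod (\<Sum>k\<in>B. f k t))\<^sup>2) \<partial>\<mu>) \<le> ennreal (\<Sum>k\<in>B. c k)"
  shows "\<exists>F\<in>borel_measurable \<mu>. (\<forall>t. 0 \<le> F t) \<and>
    (\<forall>n t. cmod (\<Sum>k\<in>set (take n xs). f k t) \<le> F t) \<and>
    (\<integral>\<^sup>+t. ennreal ((F t)\<^sup>2) \<partial>\<mu>) \<le> ennreal ((real r + 1)\<^sup>2 * (\<Sum>k\<in>set xs. c k))"
  using assms
proof (induction r arbitrary: xs)
  case 0
  define F where "F t = cmod (\<Sum>k\<in>set xs. f k t)" for t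
  have "F \<in> borel_measurable \<mu>"
    unfolding F_def using "0.prems"(3) by measurable
  moreover have "cmod (\<Sum>k\<in>set (take n xs). f k t) \<le> F t" for n t
  proof (cases "n = 0")
    case True
    then show ?thesis by (simp add: F_def)
  next
    case False
    then have "take n xs = xs" using "0.prems"(2) by simp
    then show ?thesis by (simp add: F_def)
  qed
  moreover have "(\<integral>\<^sup>+t. ennreal ((F t)\<^sup>2) \<partial>\<mu>) \<le> ennreal (\<Sum>k\<in>set xs. c k)"
    unfolding F_def by (rule "0.prems"(5)) simp
  ultimately show ?case
    by (intro bexI[of _ F]) (auto simp: F_def)
next
  case (Suc r)
  define ys where "ys = take (2 ^ r) xs"
  define zs where "zs = drop (2 ^ r) xs"
  have xs: "xs = ys @ zs" by (simp add: ys_def zs_def)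
  have dist: "distinct ys" "distinct zs" "set ys \<inter> set zs = {}"
    using Suc.prems(1) by (auto simp: xs)
  have len: "length ys \<le> 2 ^ r" "length zs \<le> 2 ^ r"
    using Suc.prems(2) by (auto simp: ys_def zs_def)
  have sub: "set ys \<subseteq> set xs" "set zs \<subseteq> set xs" by (auto simp: xs)
  obtain F where F: "F \<in> borel_measurable \<mu>" "\<And>t. 0 \<le> F t"
      "\<And>n t. cmod (\<Sum>k\<in>set (take n ys). f k t) \<le> F t"
      "(\<integral>\<^sup>+t. ennreal ((F t)\<^sup>2) \<partial>\<mu>) \<le> ennreal ((real r + 1)\<^sup>2 * (\<Sum>k\<in>set ys. c k))"
    using Suc.IH[OF dist(1) len(1) Suc.prems(3) Suc.prems(4) Suc.prems(5)] sub by blast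
  obtain G where G: "G \<in> borel_measurable \<mu>" "\<And>t. 0 \<le> G t"
      "\<And>n t. cmod (\<Sum>k\<in>set (take n zs). f k t) \<le> G t"
      "(\<integral>\<^sup>+t. ennreal ((G t)\<^sup>2) \<partial>\<mu>) \<le> ennreal ((real r + 1)\<^sup>2 * (\<Sum>k\<in>set zs. c k))"
    using Suc.IH[OF dist(2) len(2) Suc.prems(3) Suc.prems(4) Suc.prems(5)] sub by blast
  define L where "L t = cmod (\<Sum>k\<in>set ys. f k t)" for t
  define H where "H t = L t + max (F t) (G t)" for t
  note [measurable] = F(1) G(1)
  have L[measurable]: "L \<in> borel_measurable \<mu>"
    unfolding L_def using Suc.prems(3) sub by measurable (use sub in auto)
  have "H \<in> borel_measurable \<mu>"
    unfolding H_def by measurable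
  moreover have "0 \<le> H t" for t
    using F(2)[of t] by (simp add: H_def L_def)
  moreover have "cmod (\<Sum>k\<in>set (take n xs). f k t) \<le> H t" for n t
  proof (cases "n \<le> length ys")
    case True
    then have "take n xs = take n ys" by (simp add: xs)
    then show ?thesis
      using F(3)[of t n] by (simp add: H_def L_def add_increasing)
  next
    case False
    then have "take n xs = ys @ take (n - length ys) zs" by (simp add: xs)
    moreover have "set ys \<inter> set (take (n - length ys) zs) = {}"
      using dist(3) set_take_subset[of "n - length ys" zs] by blast
    ultimately have "(\<Sum>k\<in>set (take n xs). f k t) =
        (\<Sum>k\<in>set ys. f k t) + (\<Sum>k\<in>set (take (n - length ys) zs). f k t)"
      by (simp add: sum.union_disjoint)
    also have "cmod \<dots> \<le> L t + G t"
      unfolding L_def by (rule order_trans[OF norm_triangle_ineq]) (simp add: G(3))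
    finally show ?thesis by (simp add: H_def)
  qed
  moreover have "(\<integral>\<^sup>+t. ennreal ((H t)\<^sup>2) \<partial>\<mu>) \<le>
      ennreal ((real (Suc r) + 1)\<^sup>2 * (\<Sum>k\<in>set xs. c k))"
  proof -
    \<comment> \<open>\<open>s\<^sup>2\<close> is the constant of both halves. As
      \<open>v * s\<^sup>2 = s * (s + 1)\<close>, the left half collects (s + 1) + s (s + 1) = (s +
      1)^2 and the right half s (s + 1), so (s + 1)^2 serves for both.\<close>
    define s where "s = real r + 1"
    have s: "0 < s" by (simp add: s_def)
    define cy where "cy = (\<Sum>k\<in>set ys. c k)"
    define cz where "cz = (\<Sum>k\<in>set zs. c k)"
    have cyz: "0 \<le> cy" "0 \<le> cz"
      using Suc.prems(4) sub by (auto simp: cy_def cz_def intro!: sum_nonneg)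
    have cx: "(\<Sum>k\<in>set xs. c k) = cy + cz"
      using dist by (simp add: xs cy_def cz_def sum.union_disjoint)
    define u where "u = s + 1"
    define v where "v = (s + 1) / s"
    have uv: "0 \<le> u" "0 \<le> v" using s by (auto simp: u_def v_def)
    have "(\<integral>\<^sup>+t. ennreal ((H t)\<^sup>2) \<partial>\<mu>) \<le>
        (\<integral>\<^sup>+t. ennreal u * ennreal ((L t)\<^sup>2) +
            ennreal v * (ennreal ((F t)\<^sup>2) + ennreal ((G t)\<^sup>2)) \<partial>\<mu>)"
    proof (rule nn_integral_mono)
      fix t
      \<comment> \<open>The squared maximum costs no extra factor, so the energies of the disjoint
        halves simply add up.\<close>
      have "(max (F t) (G t))\<^sup>2 \<le> (F t)\<^sup>2 + (G t)\<^sup>2"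
        by (simp add: max_def)
      then have "v * (max (F t) (G t))\<^sup>2 \<le> v * ((F t)\<^sup>2 + (G t)\<^sup>2)"
        using uv by (intro mult_left_mono) auto
      then have "(H t)\<^sup>2 \<le> u * (L t)\<^sup>2 + v * ((F t)\<^sup>2 + (G t)\<^sup>2)"
        using power2_sum_le_weighted[OF s, of "L t" "max (F t) (G t)"] by (simp add: H_def u_def v_def)
      then have "ennreal ((H t)\<^sup>2) \<le> ennreal (u * (L t)\<^sup>2 + v * ((F t)\<^sup>2 + (G t)\<^sup>2))"
        by (rule ennreal_leI)
      then show "ennreal ((H t)\<^sup>2) \<le> ennreal u * ennreal ((L t)\<^sup>2) +
            ennreal v * (ennreal ((F t)\<^sup>2) + ennreal ((G t)\<^sup>2))"
        using uv by (simp add: ennreal_mult')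
    qed
    also have "\<dots> = ennreal u * (\<integral>\<^sup>+t. ennreal ((L t)\<^sup>2) \<partial>\<mu>) + ennreal v *
        ((\<integral>\<^sup>+t. ennreal ((F t)\<^sup>2) \<partial>\<mu>) + (\<integral>\<^sup>+t. ennreal ((G t)\<^sup>2) \<partial>\<mu>))"
      by (simp add: nn_integral_add nn_integral_cmult)
    also have "\<dots> \<le> ennreal u * ennreal cy +
        ennreal v * (ennreal (s\<^sup>2 * cy) + ennreal (s\<^sup>2 * cz))"
      using F(4) G(4) Suc.prems(5)[OF sub(1)]
      by (intro add_mono mult_left_mono) (auto simp: s_def cy_def cz_def L_def)
    also have "\<dots> = ennreal (u * cy + v * (s\<^sup>2 * cy + s\<^sup>2 * cz))"
      using uv cyz by (simp add: ennreal_mult')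
    also have "\<dots> \<le> ennreal ((s + 1)\<^sup>2 * (cy + cz))"
      using s cyz by (intro ennreal_leI) (simp add: u_def v_def field_simps power2_eq_square)
    finally show ?thesis by (simp add: cx s_def u_def add_ac)
  qed
  ultimately show ?case by blast
qed

text \<open>Sorting \<open>A\<close> by \<open>h\<close> makes every sublevel set of
  \<open>h\<close> a prefix of the list, so the maximum over prefixes covers it; ties in
  \<open>h\<close> do no harm. Orthogonality is expressed as an energy bound for all subsets
  \<open>B\<close>.\<close>

lemma rademacher_menshov:
  fixes f :: "'k \<Rightarrow> 't \<Rightarrow> complex" and c :: "'k \<Rightarrow> real" and h :: "'k \<Rightarrow> nat"
  assumes "finite A" and "card A \<le> 2 ^ r"
    and "\<And>k. k \<in> A \<Longrightarrow> f k \<in> borel_measurable \<mu>"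
    and "\<And>k. k \<in> A \<Longrightarrow> 0 \<le> c k"
    and "\<And>B. B \<subseteq> A \<Longrightarrow>
      (\<integral>\<^sup>+t. ennreal ((cmod (\<Sum>k\<in>B. f k t))\<^sup>2) \<partial>\<mu>) \<le> ennreal (\<Sum>k\<in>B. c k)"
  shows "\<exists>F\<in>borel_measurable \<mu>. (\<forall>t. 0 \<le> F t) \<and>
    (\<forall>n t. cmod (\<Sum>k\<in>{k\<in>A. h k \<le> n}. f k t) \<le> F t) \<and>
    (\<integral>\<^sup>+t. ennreal ((F t)\<^sup>2) \<partial>\<mu>) \<le> ennreal ((real r + 1)\<^sup>2 * (\<Sum>k\<in>A. c k))"
proof -
  obtain ys where ys: "set ys = A" "distinct ys"
    using finite_distinct_list[OF assms(1)] by blast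
  define xs where "xs = sort_key h ys"
  have xs: "set xs = A" "distinct xs" "sorted (map h xs)"
    by (simp_all add: xs_def ys)
  have len: "length xs \<le> 2 ^ r"
    using assms(2) xs distinct_card by metis
  have take: "{k\<in>A. h k \<le> n} = set (take (length (takeWhile (\<lambda>k. h k \<le> n) xs)) xs)" for n
  proof -
    have "sorted (map h zs) \<Longrightarrow> set (takeWhile (\<lambda>k. h k \<le> n) zs) = {k\<in>set zs. h k \<le> n}" for zs
      by (induction zs) force+
    then show ?thesis
      using xs takeWhile_eq_take[of "\<lambda>k. h k \<le> n" xs] by simp
  qed
  show ?thesis
    using rademacher_menshov_list[of xs r f \<mu> c] assms(3-5) xs len unfolding take by blast
qed

section \<open>Splitting one block of coefficients into dyadic layers\<close>

lemma sum_inverse_squares_le: "(\<Sum>i<n. 1 / (real i + 1)\<^sup>2) \<le> 2 - 1 / real n"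
proof (induction n)
  case (Suc n)
  show ?case
  \<comment> \<open>The telescoping estimate divides by n. Since \<open>1 / 0 = 0\<close>, the
    induction hypothesis at 0 is too weak, and the claim for one summand, 1 \<le> 1, is checked
    directly.\<close>
  proof (cases "n = 0")
    case False
    then have "1 / (real n + 1)\<^sup>2 \<le> 1 / real n - 1 / (real n + 1)"
      by (simp add: divide_simps power2_eq_square)
    then show ?thesis using Suc by (simp add: add_ac)
  qed simp
qed simp

text \<open>
  Of the weight \<open>(i + 1)\<^sup>4\<close>, one square comes from the Rademacher-Menshov inequality in the \<open>i\<close>-th layer
  and the other from the Cauchy-Schwarz inequality over the layers.
\<close>

lemma maximal_bound_by_level_counts:
  fixes e :: "'k \<Rightarrow> 't \<Rightarrow> complex" and x :: "'k \<Rightarrow> real" and h :: "'k \<Rightarrow> nat"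
    and A :: "'k set" and a C :: real
  defines "K \<equiv> \<lambda>i. real (card {k\<in>A. a / 2 ^ i < \<bar>x k\<bar>})"
  assumes A: "finite A" and a: "0 < a" and C: "0 \<le> C"
    and meas: "\<And>k. k \<in> A \<Longrightarrow> e k \<in> borel_measurable \<mu>"
    and orth: "\<And>B. B \<subseteq> A \<Longrightarrow>
      (\<integral>\<^sup>+t. ennreal ((cmod (\<Sum>k\<in>B. e k t * of_real (x k)))\<^sup>2) \<partial>\<mu>) \<le> ennreal (\<Sum>k\<in>B. C * (x k)\<^sup>2)"
    and small: "(\<Sum>i. ennreal ((real i + 1) ^ 4 / 4 ^ i * K i)) < 1"
  shows "\<exists>F\<in>borel_measurable \<mu>. (\<forall>t. 0 \<le> F t) \<and>
    (\<forall>n t. cmod (\<Sum>k\<in>{k\<in>A. h k \<le> n}. e k t * of_real (x k)) \<le> F t) \<and>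
    (\<integral>\<^sup>+t. ennreal ((F t)\<^sup>2) \<partial>\<mu>) \<le>
      ennreal (32 * C * a\<^sup>2) * (\<Sum>i. ennreal ((real i + 1) ^ 4 / 4 ^ i * K i))"
proof -
  let ?w = "\<lambda>i. (real i + 1) ^ 4 / 4 ^ i"
  have K_nonneg: "0 \<le> K i" for i by (simp add: K_def)
  \<comment> \<open>A series of nonnegative terms with sum below 1 has every term below 1. As (i +
    1)^4 is at least 1, this gives \<open>K i \<le> 4 ^ i\<close>; at i = 0 the count is a natural
    number below 1, hence 0, so no coefficient exceeds \<open>a\<close>.\<close>
  have wK: "?w i * K i < 1" for i
  proof -
    have "ennreal (?w i * K i) < 1"
      using ennreal_suminf_lessD[OF small] .
    then show ?thesis by (simp add: ennreal_less_one_iff)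
  qed
  have K_le: "K i \<le> 4 ^ i" for i
  proof -
    have "1 * K i \<le> (real i + 1) ^ 4 * K i"
      using K_nonneg by (intro mult_right_mono one_le_power) auto
    also have "\<dots> \<le> 4 ^ i"
      using wK[of i] by (simp add: field_simps)
    finally show ?thesis by simp
  qed
  have x_le: "\<bar>x k\<bar> \<le> a" if "k \<in> A" for k
  proof -
    have "K 0 < 1" using wK[of 0] by simp
    then have "card {k\<in>A. a < \<bar>x k\<bar>} = 0" by (simp add: K_def)
    then show ?thesis using A that by force
  qed
  have ex_level: "\<exists>j. a / 2 ^ Suc j < \<bar>x k\<bar>" if "x k \<noteq> 0" for k
  proof -
    have "0 < \<bar>x k\<bar> / a" using that a by simp
    then obtain j where "(1 / 2) ^ j < \<bar>x k\<bar> / a"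
      using real_arch_pow_inv[of "\<bar>x k\<bar> / a" "1 / 2"] by auto
    then have j: "a / 2 ^ j < \<bar>x k\<bar>" using a by (simp add: field_simps power_divide)
    have "a / 2 ^ Suc j \<le> a / 2 ^ j" using a by (simp add: field_simps)
    with j have "a / 2 ^ Suc j < \<bar>x k\<bar>" by linarith
    then show ?thesis by blast
  qed
  \<comment> \<open>Level i has upper end \<open>a / 2 ^ i\<close> and lower end
    \<open>a / 2 ^ Suc i\<close>, so its members are counted by \<open>K (Suc i)\<close>. A zero
    coefficient has no level; \<open>A'\<close> discards it without changing any sum.\<close>
  define lev where "lev k = (LEAST j. a / 2 ^ Suc j < \<bar>x k\<bar>)" for k
  have lev_gt: "a / 2 ^ Suc (lev k) < \<bar>x k\<bar>" if "x k \<noteq> 0" for k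
    unfolding lev_def using LeastI_ex[OF ex_level[OF that]] .
  have lev_le: "\<bar>x k\<bar> \<le> a / 2 ^ lev k" if "k \<in> A" for k
  proof (cases "lev k")
    case 0
    then show ?thesis using x_le[OF that] by simp
  next
    case (Suc j)
    then have "\<not> a / 2 ^ Suc j < \<bar>x k\<bar>"
      using not_less_Least[of j "\<lambda>j. a / 2 ^ Suc j < \<bar>x k\<bar>"] by (simp add: lev_def)
    then show ?thesis using Suc by simp
  qed
  define A' where "A' = {k\<in>A. x k \<noteq> 0}"
  define L where "L i = {k\<in>A'. lev k = i}" for i
  have fin: "finite A'" "\<And>i. finite (L i)" and sub: "\<And>i. L i \<subseteq> A" "A' \<subseteq> A"
    using A by (auto simp: A'_def L_def)
  have card_L: "real (card (L i)) \<le> K (Suc i)" for i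
    unfolding K_def using A lev_gt by (auto simp: L_def A'_def intro!: card_mono)
  define Q where "Q i F \<longleftrightarrow> F \<in> borel_measurable \<mu> \<and> (\<forall>t. 0 \<le> F t) \<and>
    (\<forall>n t. cmod (\<Sum>k\<in>{k\<in>L i. h k \<le> n}. e k t * of_real (x k)) \<le> F t) \<and>
    (\<integral>\<^sup>+t. ennreal ((F t)\<^sup>2) \<partial>\<mu>) \<le> ennreal ((real (2 * i + 2) + 1)\<^sup>2 * (\<Sum>k\<in>L i. C * (x k)\<^sup>2))"
    for i F
  have "\<exists>F. Q i F" for i
    unfolding Q_def Bex_def[symmetric]
  proof (rule rademacher_menshov)
    \<comment> \<open>The exponent comes from \<open>K (Suc i) \<le> 4 ^ Suc i\<close>: the
      logarithmic loss is linear in i, however large \<open>A\<close> is.\<close>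
    have "real (card (L i)) \<le> 2 ^ (2 * i + 2)"
      using card_L[of i] K_le[of "Suc i"] by (simp add: power_add power_mult)
    then show "card (L i) \<le> 2 ^ (2 * i + 2)"
      using of_nat_le_iff[where 'a=real] by fastforce
    show "(\<lambda>t. e k t * of_real (x k)) \<in> borel_measurable \<mu>" if "k \<in> L i" for k
    proof -
      have [measurable]: "e k \<in> borel_measurable \<mu>"
        using meas that sub by blast
      show ?thesis by measurable
    qed
    show "(\<integral>\<^sup>+t. ennreal ((cmod (\<Sum>k\<in>B. e k t * of_real (x k)))\<^sup>2) \<partial>\<mu>)
        \<le> ennreal (\<Sum>k\<in>B. C * (x k)\<^sup>2)" if "B \<subseteq> L i" for B
      using that sub by (intro orth) blast
  qed (use fin C in auto)
  then obtain F where "\<And>i. Q i (F i)"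
    by metis
  then have F: "\<And>i. F i \<in> borel_measurable \<mu>" "\<And>i t. 0 \<le> F i t"
      "\<And>i n t. cmod (\<Sum>k\<in>{k\<in>L i. h k \<le> n}. e k t * of_real (x k)) \<le> F i t"
      "\<And>i. (\<integral>\<^sup>+t. ennreal ((F i t)\<^sup>2) \<partial>\<mu>) \<le> ennreal ((real (2 * i + 2) + 1)\<^sup>2 * (\<Sum>k\<in>L i. C * (x k)\<^sup>2))"
    unfolding Q_def by blast+
  note [measurable] = F(1)
  \<comment> \<open>Finitely many levels are occupied, so a finite sum of the \<open>F i\<close>
    dominates. The final bound does not depend on \<open>I\<close>.\<close>
  obtain I where I: "\<And>k. k \<in> A' \<Longrightarrow> lev k < I"
    using finite_nat_set_iff_bounded[of "lev ` A'"] fin(1) by auto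
  define G where "G t = (\<Sum>i<I. F i t)" for t
  have "G \<in> borel_measurable \<mu>"
    unfolding G_def by measurable
  moreover have "0 \<le> G t" for t
    using F(2) by (simp add: G_def sum_nonneg)
  moreover have "cmod (\<Sum>k\<in>{k\<in>A. h k \<le> n}. e k t * of_real (x k)) \<le> G t" for n t
  proof -
    have "(\<Sum>k\<in>{k\<in>A. h k \<le> n}. e k t * of_real (x k)) =
        (\<Sum>k\<in>{k\<in>A'. h k \<le> n}. e k t * of_real (x k))"
      using A by (intro sum.mono_neutral_right) (auto simp: A'_def)
    also have "\<dots> = (\<Sum>i<I. \<Sum>k\<in>{k\<in>{k\<in>A'. h k \<le> n}. lev k = i}. e k t * of_real (x k))"
      using I fin by (intro sum.group[symmetric]) auto
    also have "\<dots> = (\<Sum>i<I. \<Sum>k\<in>{k\<in>L i. h k \<le> n}. e k t * of_real (x k))"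
      by (intro sum.cong refl) (auto simp: L_def)
    also have "cmod \<dots> \<le> G t"
      unfolding G_def using F(3) by (rule sum_norm_le)
    finally show ?thesis .
  qed
  moreover have "(\<integral>\<^sup>+t. ennreal ((G t)\<^sup>2) \<partial>\<mu>) \<le>
      ennreal (32 * C * a\<^sup>2) * (\<Sum>i. ennreal (?w i * K i))"
  proof -
    \<comment> \<open>Here (2i + 3)^2 \<le> 4 (i + 2)^2 and 2 (i + 1)^2 \<le> 2 (i + 2)^2, while a^2
      / 4^i = 4 a^2 / 4^(i + 1). The product of the constants is 4 * 2 * 4 = 32, and (i + 2)^4 is
      the weight at \<open>Suc i\<close>.\<close>
    have bound: "(real (2 * i + 2) + 1)\<^sup>2 * (\<Sum>k\<in>L i. C * (x k)\<^sup>2) * (2 * (real i + 1)\<^sup>2) \<le>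
        32 * C * a\<^sup>2 * (?w (Suc i) * K (Suc i))" for i
    proof -
      have "(\<Sum>k\<in>L i. C * (x k)\<^sup>2) \<le> (\<Sum>k\<in>L i. C * (a / 2 ^ i)\<^sup>2)"
      proof (intro sum_mono mult_left_mono C)
        fix k assume "k \<in> L i"
        then have "\<bar>x k\<bar> \<le> a / 2 ^ i" using lev_le[of k] sub by (auto simp: L_def)
        then have "\<bar>x k\<bar>\<^sup>2 \<le> (a / 2 ^ i)\<^sup>2" by (intro power_mono) auto
        then show "(x k)\<^sup>2 \<le> (a / 2 ^ i)\<^sup>2" by simp
      qed
      also have "\<dots> = real (card (L i)) * (C * (a / 2 ^ i)\<^sup>2)" by simp
      also have "\<dots> \<le> K (Suc i) * (C * (a / 2 ^ i)\<^sup>2)"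
        using card_L C by (intro mult_right_mono) auto
      finally have s: "(\<Sum>k\<in>L i. C * (x k)\<^sup>2) \<le> K (Suc i) * (C * (a / 2 ^ i)\<^sup>2)" .
      have p: "(2 ^ i :: real)\<^sup>2 = 4 ^ i"
        by (simp add: power2_eq_square flip: power_mult_distrib)
      have "(real (2 * i + 2) + 1)\<^sup>2 \<le> (2 * (real i + 2))\<^sup>2"
        by (intro power_mono) auto
      moreover have "(real i + 1)\<^sup>2 \<le> (real i + 2)\<^sup>2"
        by (intro power_mono) auto
      ultimately have "(real (2 * i + 2) + 1)\<^sup>2 * (\<Sum>k\<in>L i. C * (x k)\<^sup>2) * (2 * (real i + 1)\<^sup>2) \<le>
        (2 * (real i + 2))\<^sup>2 * (K (Suc i) * (C * (a / 2 ^ i)\<^sup>2)) * (2 * (real i + 2)\<^sup>2)"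
        using s C K_nonneg by (intro mult_mono) (auto intro!: sum_nonneg mult_nonneg_nonneg)
      also have "\<dots> = 32 * C * a\<^sup>2 * (?w (Suc i) * K (Suc i))"
        by (simp add: power_divide p field_simps) (simp add: power2_eq_square power4_eq_xxxx, simp add: algebra_simps)
      finally show ?thesis .
    qed
    have "(\<integral>\<^sup>+t. ennreal ((G t)\<^sup>2) \<partial>\<mu>) \<le>
        (\<integral>\<^sup>+t. (\<Sum>i<I. ennreal (2 * (real i + 1)\<^sup>2) * ennreal ((F i t)\<^sup>2)) \<partial>\<mu>)"
    proof (rule nn_integral_mono)
      fix t
      \<comment> \<open>The squares of the weights 1 / (i + 1) sum to at most 2, so the
        Cauchy-Schwarz inequality costs the factor 2 (i + 1)^2 on layer i.\<close>
      have "(G t)\<^sup>2 = (\<Sum>i<I. 1 / (real i + 1) * ((real i + 1) * F i t))\<^sup>2"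
        unfolding G_def by (intro arg_cong[where f="\<lambda>y. y\<^sup>2"] sum.cong) (auto simp: field_simps)
      also have "\<dots> \<le> (\<Sum>i<I. (1 / (real i + 1))\<^sup>2) * (\<Sum>i<I. ((real i + 1) * F i t)\<^sup>2)"
        by (rule Cauchy_Schwarz_ineq_sum)
      also have "\<dots> \<le> 2 * (\<Sum>i<I. ((real i + 1) * F i t)\<^sup>2)"
      proof (intro mult_right_mono sum_nonneg)
        have "2 - 1 / real I \<le> 2" by simp
        from order_trans[OF sum_inverse_squares_le this] show "(\<Sum>i<I. (1 / (real i + 1))\<^sup>2) \<le> 2"
          by (simp add: power_divide)
      qed auto
      also have "\<dots> = (\<Sum>i<I. (2 * (real i + 1)\<^sup>2) * (F i t)\<^sup>2)"
        by (simp add: sum_distrib_left power_mult_distrib mult_ac)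
      finally have "ennreal ((G t)\<^sup>2) \<le> ennreal (\<Sum>i<I. (2 * (real i + 1)\<^sup>2) * (F i t)\<^sup>2)"
        by (rule ennreal_leI)
      also have "\<dots> = (\<Sum>i<I. ennreal ((2 * (real i + 1)\<^sup>2) * (F i t)\<^sup>2))"
        by (subst sum_ennreal) auto
      also have "\<dots> = (\<Sum>i<I. ennreal (2 * (real i + 1)\<^sup>2) * ennreal ((F i t)\<^sup>2))"
        by (intro sum.cong refl ennreal_mult) auto
      finally show "ennreal ((G t)\<^sup>2) \<le> \<dots>" .
    qed
    also have "\<dots> = (\<Sum>i<I. ennreal (2 * (real i + 1)\<^sup>2) * (\<integral>\<^sup>+t. ennreal ((F i t)\<^sup>2) \<partial>\<mu>))"
      by (subst nn_integral_sum) (auto intro!: sum.cong nn_integral_cmult)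
    also have "\<dots> \<le> (\<Sum>i<I. ennreal (32 * C * a\<^sup>2) * ennreal (?w (Suc i) * K (Suc i)))"
    proof (rule sum_mono)
      fix i
      have "ennreal (2 * (real i + 1)\<^sup>2) * (\<integral>\<^sup>+t. ennreal ((F i t)\<^sup>2) \<partial>\<mu>) \<le>
          ennreal (2 * (real i + 1)\<^sup>2) * ennreal ((real (2 * i + 2) + 1)\<^sup>2 * (\<Sum>k\<in>L i. C * (x k)\<^sup>2))"
        by (intro mult_left_mono F(4)) auto
      also have "\<dots> = ennreal ((real (2 * i + 2) + 1)\<^sup>2 * (\<Sum>k\<in>L i. C * (x k)\<^sup>2) * (2 * (real i + 1)\<^sup>2))"
        using C by (subst ennreal_mult[symmetric]) (auto intro!: sum_nonneg mult_nonneg_nonneg simp: mult_ac)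
      also have "\<dots> \<le> ennreal (32 * C * a\<^sup>2 * (?w (Suc i) * K (Suc i)))"
        by (rule ennreal_leI[OF bound])
      also have "\<dots> = ennreal (32 * C * a\<^sup>2) * ennreal (?w (Suc i) * K (Suc i))"
        using C K_nonneg by (intro ennreal_mult) auto
      finally show "ennreal (2 * (real i + 1)\<^sup>2) * (\<integral>\<^sup>+t. ennreal ((F i t)\<^sup>2) \<partial>\<mu>) \<le> \<dots>" .
    qed
    also have "\<dots> = ennreal (32 * C * a\<^sup>2) * (\<Sum>i\<in>Suc ` {..<I}. ennreal (?w i * K i))"
      by (simp add: sum_distrib_left sum.reindex)
    also have "\<dots> \<le> ennreal (32 * C * a\<^sup>2) * (\<Sum>i. ennreal (?w i * K i))"
      by (intro mult_left_mono sum_le_suminf) auto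
    finally show ?thesis .
  qed
  ultimately show ?thesis by blast
qed

section \<open>From dyadic blocks to almost everywhere convergence\<close>

text \<open>If \<open>F m\<close> dominates all partial sums inside the block up to
  \<open>2 ^ m\<close>, and \<open>a m\<close> is the normalization there, the layer bound and
  \<open>total\<close> make the integrals of \<open>(F m t / a m)\<^sup>2\<close> summable over m.
  Hence \<open>F m t / a m\<close> tends to 0 for almost every t, and this controls all n between
  consecutive powers of two.\<close>

lemma AE_partial_sums_tendsto_zero:
  fixes e :: "'k \<Rightarrow> 't \<Rightarrow> complex" and x :: "'k \<Rightarrow> real" and h :: "'k \<Rightarrow> nat"
  assumes fin: "\<And>n. finite {k\<in>J. h k \<le> n}"
    and C: "0 \<le> C" and q: "0 < q"
    and meas: "\<And>k. k \<in> J \<Longrightarrow> e k \<in> borel_measurable \<mu>"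
    and orth: "\<And>B. finite B \<Longrightarrow> B \<subseteq> J \<Longrightarrow>
      (\<integral>\<^sup>+t. ennreal ((cmod (\<Sum>k\<in>B. e k t * of_real (x k)))\<^sup>2) \<partial>\<mu>) \<le> ennreal (\<Sum>k\<in>B. C * (x k)\<^sup>2)"
    and total: "(\<Sum>m. \<Sum>i. ennreal ((real i + 1) ^ 4 / 4 ^ i *
      real (card {k\<in>{k\<in>J. h k \<le> 2 ^ m}. (2 ^ m) powr q / 2 ^ i < \<bar>x k\<bar>}))) < \<infinity>"
  shows "AE t in \<mu>. (\<lambda>n. (\<Sum>k\<in>{k\<in>J. h k \<le> n}. e k t * of_real (x k)) / of_real (real n powr q))
    \<longlonglongrightarrow> 0"
proof -
  define a :: "nat \<Rightarrow> real" where "a m = (2 ^ m) powr q" for m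
  have a_pos: "0 < a m" for m by (simp add: a_def)
  define T where "T m = (\<Sum>i. ennreal ((real i + 1) ^ 4 / 4 ^ i *
      real (card {k\<in>{k\<in>J. h k \<le> 2 ^ m}. a m / 2 ^ i < \<bar>x k\<bar>})))" for m
  have T: "(\<Sum>m. T m) < \<infinity>"
    using total unfolding T_def a_def .
  define \<tau> where "\<tau> m = enn2real (T m)" for m
  have T_eq: "T m = ennreal (\<tau> m)" for m
    using ennreal_suminf_lessD[OF T] by (simp add: \<tau>_def)
  have "(\<Sum>m. ennreal (\<tau> m)) \<noteq> top"
    using T by (subst T_eq[symmetric]) auto
  then have "summable \<tau>"
    by (intro summable_suminf_not_top) (auto simp: \<tau>_def)
  then have "\<tau> \<longlonglongrightarrow> 0"
    by (rule summable_LIMSEQ_zero)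
  then have "\<forall>\<^sub>F m in sequentially. \<tau> m < 1"
    by (rule order_tendstoD) simp
  then obtain m0 where m0: "\<And>m. m0 \<le> m \<Longrightarrow> \<tau> m < 1"
    by (auto simp: eventually_sequentially)
  \<comment> \<open>The layer bound requires a total below 1, which holds from \<open>m0\<close> on.
    For smaller m the zero function is used, so that \<open>F m\<close> is defined for all m and the
    series can start at 0.\<close>
  define Q where "Q m F \<longleftrightarrow> F \<in> borel_measurable \<mu> \<and> (\<forall>t. 0 \<le> F t) \<and>
    (m0 \<le> m \<longrightarrow> (\<forall>n t. cmod (\<Sum>k\<in>{k\<in>{k\<in>J. h k \<le> 2 ^ m}. h k \<le> n}. e k t * of_real (x k)) \<le> F t)) \<and>
    (\<integral>\<^sup>+t. ennreal ((F t)\<^sup>2) \<partial>\<mu>) \<le> ennreal (32 * C * (a m)\<^sup>2) * T m" for m F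
  have "\<exists>F. Q m F" for m
  proof (cases "m0 \<le> m")
    case True
    have "T m < 1" using m0[OF True] by (simp add: T_eq ennreal_less_one_iff)
    then have "\<exists>F\<in>borel_measurable \<mu>. (\<forall>t. 0 \<le> F t) \<and>
      (\<forall>n t. cmod (\<Sum>k\<in>{k\<in>{k\<in>J. h k \<le> 2 ^ m}. h k \<le> n}. e k t * of_real (x k)) \<le> F t) \<and>
      (\<integral>\<^sup>+t. ennreal ((F t)\<^sup>2) \<partial>\<mu>) \<le> ennreal (32 * C * (a m)\<^sup>2) * T m"
      unfolding T_def
    proof (intro maximal_bound_by_level_counts fin a_pos C)
      show "e k \<in> borel_measurable \<mu>" if "k \<in> {k\<in>J. h k \<le> 2 ^ m}" for k
        using that by (intro meas) simp
      show "(\<integral>\<^sup>+t. ennreal ((cmod (\<Sum>k\<in>B. e k t * of_real (x k)))\<^sup>2) \<partial>\<mu>)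
          \<le> ennreal (\<Sum>k\<in>B. C * (x k)\<^sup>2)" if "B \<subseteq> {k\<in>J. h k \<le> 2 ^ m}" for B
        using that finite_subset[OF that fin] by (intro orth) auto
    qed
    then show ?thesis unfolding Q_def by blast
  next
    case False
    then have "Q m (\<lambda>_. 0)" by (simp add: Q_def)
    then show ?thesis by blast
  qed
  then obtain F where "\<And>m. Q m (F m)"
    by metis
  then have F: "\<And>m. F m \<in> borel_measurable \<mu>" "\<And>m t. 0 \<le> F m t"
    "\<And>m n t. m0 \<le> m \<Longrightarrow>
      cmod (\<Sum>k\<in>{k\<in>{k\<in>J. h k \<le> 2 ^ m}. h k \<le> n}. e k t * of_real (x k)) \<le> F m t"
    "\<And>m. (\<integral>\<^sup>+t. ennreal ((F m t)\<^sup>2) \<partial>\<mu>) \<le> ennreal (32 * C * (a m)\<^sup>2) * T m"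
    unfolding Q_def by blast+
  note [measurable] = F(1)
  have "(\<integral>\<^sup>+t. (\<Sum>m. ennreal ((F m t / a m)\<^sup>2)) \<partial>\<mu>) = (\<Sum>m. \<integral>\<^sup>+t. ennreal ((F m t / a m)\<^sup>2) \<partial>\<mu>)"
    by (intro nn_integral_suminf) measurable
  also have "\<dots> \<le> (\<Sum>m. ennreal (32 * C) * T m)"
  proof (intro suminf_le summableI)
    fix m
    have "(\<integral>\<^sup>+t. ennreal ((F m t / a m)\<^sup>2) \<partial>\<mu>) = (\<integral>\<^sup>+t. ennreal (1 / (a m)\<^sup>2) * ennreal ((F m t)\<^sup>2) \<partial>\<mu>)"
      by (intro nn_integral_cong) (simp add: power_divide flip: ennreal_mult)
    also have "\<dots> = ennreal (1 / (a m)\<^sup>2) * (\<integral>\<^sup>+t. ennreal ((F m t)\<^sup>2) \<partial>\<mu>)"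
      by (rule nn_integral_cmult) measurable
    also have "\<dots> \<le> ennreal (1 / (a m)\<^sup>2) * (ennreal (32 * C * (a m)\<^sup>2) * T m)"
      by (intro mult_left_mono F(4)) simp
    also have "\<dots> = ennreal (1 / (a m)\<^sup>2 * (32 * C * (a m)\<^sup>2)) * T m"
      using C by (subst ennreal_mult) (auto simp: mult.assoc)
    also have "1 / (a m)\<^sup>2 * (32 * C * (a m)\<^sup>2) = 32 * C"
      using a_pos[of m] by simp
    finally show "(\<integral>\<^sup>+t. ennreal ((F m t / a m)\<^sup>2) \<partial>\<mu>) \<le> ennreal (32 * C) * T m" .
  qed
  also have "\<dots> = ennreal (32 * C) * (\<Sum>m. T m)"
    by (rule ennreal_suminf_cmult)
  also have "\<dots> < \<infinity>"
    using T by (simp add: ennreal_mult_less_top)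
  finally have "(\<integral>\<^sup>+t. (\<Sum>m. ennreal ((F m t / a m)\<^sup>2)) \<partial>\<mu>) \<noteq> \<infinity>" by simp
  then have "AE t in \<mu>. (\<Sum>m. ennreal ((F m t / a m)\<^sup>2)) \<noteq> \<infinity>"
    by (intro nn_integral_PInf_AE) measurable
  then show ?thesis
  proof (rule AE_mp, intro AE_I2 impI)
    fix t assume "(\<Sum>m. ennreal ((F m t / a m)\<^sup>2)) \<noteq> \<infinity>"
    then have "summable (\<lambda>m. (F m t / a m)\<^sup>2)"
      by (intro summable_suminf_not_top) auto
    then have "(\<lambda>m. (F m t / a m)\<^sup>2) \<longlonglongrightarrow> 0"
      by (rule summable_LIMSEQ_zero)
    from tendsto_real_sqrt[OF this] have "(\<lambda>m. \<bar>F m t / a m\<bar>) \<longlonglongrightarrow> 0"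
      by simp
    then have lim: "(\<lambda>m. F m t / a m) \<longlonglongrightarrow> 0"
      by (rule tendsto_rabs_zero_cancel)
    show "(\<lambda>n. (\<Sum>k\<in>{k\<in>J. h k \<le> n}. e k t * of_real (x k)) / of_real (real n powr q)) \<longlonglongrightarrow> 0"
    proof (rule LIMSEQ_I)
      fix \<epsilon> :: real assume \<epsilon>: "0 < \<epsilon>"
      then have "\<forall>\<^sub>F m in sequentially. F m t / a m < \<epsilon> / 2 powr q"
        by (intro order_tendstoD(2)[OF lim]) simp
      then obtain m1 where m1: "\<And>m. m1 \<le> m \<Longrightarrow> F m t / a m < \<epsilon> / 2 powr q"
        by (auto simp: eventually_sequentially)
      show "\<exists>no. \<forall>n\<ge>no. norm ((\<Sum>k\<in>{k\<in>J. h k \<le> n}. e k t * of_real (x k)) / of_real (real n powr q) - 0) < \<epsilon>"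
      proof (intro exI[of _ "2 ^ max m0 m1"] allI impI)
        fix n :: nat assume n: "2 ^ max m0 m1 \<le> n"
        then have n_pos: "0 < n" by (rule less_le_trans[rotated]) simp
        \<comment> \<open>By minimality \<open>2 ^ m \<le> 2 * n\<close>, so \<open>a m\<close>
          exceeds n^q by at most the factor 2^q; this is why \<open>m1\<close> was chosen for the
          tolerance \<open>\<epsilon> / 2 powr q\<close>.\<close>
        define m where "m = (LEAST m. n \<le> 2 ^ m)"
        have nm: "n \<le> 2 ^ m"
          unfolding m_def by (rule LeastI[of _ n]) (simp add: less_imp_le)
        have "max m0 m1 \<le> m"
          using order_trans[OF n nm] power_increasing_iff[of "2::nat" "max m0 m1" m] by simp
        then have m: "m0 \<le> m" "m1 \<le> m" by auto
        have "2 ^ m \<le> 2 * n"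
        proof (cases m)
          case (Suc l)
          then have "\<not> n \<le> 2 ^ l"
            using not_less_Least[of l "\<lambda>m. n \<le> 2 ^ m"] by (simp add: m_def)
          then show ?thesis using Suc by simp
        qed (use n_pos in simp)
        then have "(2::real) ^ m \<le> 2 * real n"
          by (metis of_nat_le_iff of_nat_mult of_nat_numeral of_nat_power)
        then have "a m \<le> (2 * real n) powr q"
          unfolding a_def using q by (intro powr_mono2) auto
        then have a_le: "a m \<le> 2 powr q * real n powr q"
          by (simp add: powr_mult)
        have "cmod (\<Sum>k\<in>{k\<in>J. h k \<le> n}. e k t * of_real (x k)) \<le> F m t"
        proof -
          have "{k\<in>{k\<in>J. h k \<le> 2 ^ m}. h k \<le> n} = {k\<in>J. h k \<le> n}"
            using nm by auto
          then show ?thesis using F(3)[OF m(1), of t n] by simp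
        qed
        also have "F m t < \<epsilon> / 2 powr q * a m"
          using m1[OF m(2)] a_pos[of m] by (simp add: pos_divide_less_eq)
        also have "\<dots> \<le> \<epsilon> / 2 powr q * (2 powr q * real n powr q)"
          using \<epsilon> a_le by (intro mult_left_mono) auto
        also have "\<dots> = \<epsilon> * real n powr q" by simp
        finally show "norm ((\<Sum>k\<in>{k\<in>J. h k \<le> n}. e k t * of_real (x k)) / of_real (real n powr q) - 0) < \<epsilon>"
          using n_pos by (simp add: norm_divide pos_divide_less_eq)
      qed
    qed
  qed
qed

section \<open>Orthogonality of the characters on the torus\<close>

text \<open>Lebesgue measure is the image of the product of one-dimensional Lebesgue measures under
  \<open>y \<mapsto> \<Sum>c\<in>Basis. y c *\<^sub>R c\<close>, so Fubini's theorem factorizes the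
  integral.\<close>

lemma integral_lborel_prod:
  fixes f :: "'a::euclidean_space \<Rightarrow> real \<Rightarrow> complex"
  assumes "\<And>b. b \<in> Basis \<Longrightarrow> integrable lborel (f b)"
  shows "(\<integral>x. (\<Prod>b\<in>Basis. f b (x \<bullet> b)) \<partial>lborel) = (\<Prod>b\<in>Basis. \<integral>x. f b x \<partial>lborel)"
proof -
  interpret product_sigma_finite "\<lambda>_::'a. lborel :: real measure" ..
  have [measurable]: "f b \<in> borel_measurable borel" if "b \<in> Basis" for b
    using borel_measurable_integrable[OF assms[OF that]] by simp
  have "(\<integral>x. (\<Prod>b\<in>Basis. f b (x \<bullet> b)) \<partial>lborel) =
      (\<integral>y. (\<Prod>b\<in>Basis. f b ((\<Sum>c\<in>Basis. y c *\<^sub>R c) \<bullet> b)) \<partial>(\<Pi>\<^sub>M b\<in>Basis. lborel))"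
    unfolding lborel_eq[where 'a='a] by (rule integral_distr) measurable
  also have "\<dots> = (\<integral>y. (\<Prod>b\<in>Basis. f b (y b)) \<partial>(\<Pi>\<^sub>M b\<in>Basis. lborel))"
    by (intro Bochner_Integration.integral_cong prod.cong refl) simp
  also have "\<dots> = (\<Prod>b\<in>Basis. \<integral>x. f b x \<partial>lborel)"
    by (rule product_integral_prod) (use assms in auto)
  finally show ?thesis .
qed

text \<open>The frequency is an integer because it will be a difference of two lattice coordinates.
  The half-open interval is one factor of \<open>torus\<close>; closing it changes a null set and
  allows the fundamental theorem of calculus, where periodicity cancels the endpoint values.\<close>

lemma integral_character_interval:
  fixes j :: int
  defines "g \<equiv> \<lambda>s. indicator {-pi..<pi} s *\<^sub>R exp (\<i> * of_real (of_int j * s))"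
  shows "integrable lborel g"
    and "(\<integral>s. g s \<partial>lborel) = (if j = 0 then 2 * of_real pi else 0)"
proof -
  let ?f = "\<lambda>s::real. exp (\<i> * of_real (of_int j * s)) :: complex"
  have cont: "continuous_on A ?f" for A
    by (intro continuous_intros)
  have "integrable lborel (\<lambda>s. indicator {-pi..pi} s *\<^sub>R ?f s)"
    by (rule borel_integrable_compact[OF compact_Icc cont])
  moreover have ae: "AE s in lborel. indicator {-pi..pi} s *\<^sub>R ?f s = g s"
    using AE_lborel_singleton[of pi] by eventually_elim (auto simp: g_def indicator_def)
  moreover have meas: "g \<in> borel_measurable lborel"
    unfolding g_def using borel_measurable_continuous_onI[OF cont] by measurable
  moreover have meas': "(\<lambda>s. indicator {-pi..pi} s *\<^sub>R ?f s) \<in> borel_measurable lborel"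
    using borel_measurable_continuous_onI[OF cont] by measurable
  ultimately show "integrable lborel g"
    using integrable_cong_AE by blast
  have "(\<integral>s. g s \<partial>lborel) = (\<integral>s. indicator {-pi..pi} s *\<^sub>R ?f s \<partial>lborel)"
    by (rule integral_cong_AE[OF meas meas']) (use ae in auto)
  also have "\<dots> = (if j = 0 then 2 * of_real pi else 0)"
  proof (cases "j = 0")
    case True
    then show ?thesis by (simp add: scaleR_conv_of_real)
  next
    case False
    let ?F = "\<lambda>s::real. ?f s / (\<i> * of_int j)"
    have "(\<integral>s. indicator {-pi..pi} s *\<^sub>R ?f s \<partial>lborel) = ?F pi - ?F (- pi)"
    proof (rule integral_FTC_Icc)
      fix s :: real
      have "((\<lambda>z. exp (\<i> * (of_int j * z)) / (\<i> * of_int j)) has_field_derivative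
          exp (\<i> * (of_int j * of_real s))) (at (of_real s))"
        using False by (auto intro!: derivative_eq_intros simp: mult_ac)
      from has_vector_derivative_real_field[OF this]
      show "(?F has_vector_derivative ?f s) (at s within {-pi..pi})"
        by simp
    next
      show "continuous_on {-pi..pi} ?f" by (rule cont)
    qed simp
    also have "\<dots> = 0"
    proof -
      have "?f pi = ?f (- pi) * exp (\<i> * of_real (of_int j * (2 * pi)))"
        by (simp flip: exp_add)
      also have "exp (\<i> * of_real (of_int j * (2 * pi))) = 1"
        by (rule exp_eq_1[THEN iffD2]) auto
      finally show ?thesis by simp
    qed
    finally show ?thesis using False by simp
  qed
  finally show "(\<integral>s. g s \<partial>lborel) = (if j = 0 then 2 * of_real pi else 0)" .
qed

definition character :: "nat ^ 'd \<Rightarrow> real ^ 'd \<Rightarrow> complex" where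
  "character k t = exp (\<i> * of_real (lattice_dot k t))"

text \<open>Built on Borel sets, so that joint measurability with the random variables is immediate;
  the completion enters at the very end.\<close>

definition torus_measure :: "(real ^ 'd) measure" where
  "torus_measure = restrict_space lborel torus"

lemma sets_torus[measurable]: "torus \<in> sets borel"
proof -
  have "torus = (\<Inter>i. {t :: real ^ 'd. - pi \<le> t $ i} \<inter> {t. t $ i < pi})"
    by (auto simp: torus_def)
  also have "\<dots> \<in> sets borel"
    by (intro sets.finite_INT sets.Int borel_closed borel_open
        closed_halfspace_component_ge_cart open_halfspace_component_lt_cart) auto
  finally show ?thesis .
qed

lemma finite_measure_torus: "finite_measure (torus_measure :: (real ^ 'd) measure)"
proof
  have "torus \<subseteq> cbox (\<chi> i. - pi) (\<chi> i::'d. pi)"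
    by (auto simp: torus_def mem_box_cart less_imp_le)
  then have "emeasure lborel (torus :: (real ^ 'd) set) \<le> emeasure lborel (cbox (\<chi> i. - pi) (\<chi> i::'d. pi))"
    by (intro emeasure_mono) auto
  also have "\<dots> < \<infinity>" by (rule emeasure_lborel_cbox_finite)
  finally have "emeasure lborel (torus :: (real ^ 'd) set) < \<infinity>" .
  then show "emeasure (torus_measure :: (real ^ 'd) measure) (space torus_measure) \<noteq> \<infinity>"
    by (simp add: torus_measure_def space_restrict_space emeasure_restrict_space)
qed

lemma character_measurable[measurable]: "character k \<in> borel_measurable torus_measure"
proof -
  have "character k \<in> borel_measurable borel"
    unfolding character_def lattice_dot_def
    by (intro borel_measurable_continuous_onI continuous_intros)
  then show ?thesis
    unfolding torus_measure_def by (intro measurable_restrict_space1) simp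
qed

text \<open>Both the integrand and the indicator of the torus are products over the coordinates. If
  \<open>k \<noteq> l\<close>, some coordinate has a nonzero frequency and its factor
  vanishes.\<close>

lemma integral_character:
  "(\<integral>t. character k t * cnj (character l t) \<partial>torus_measure) =
    (if k = l then (2 * of_real pi) ^ CARD('d) else 0)"
  for k l :: "nat ^ 'd"
proof -
  define g where "g i s = indicator {-pi..<pi} s *\<^sub>R
    exp (\<i> * of_real (of_int (int (k $ i) - int (l $ i)) * s))" for i and s :: real
  \<comment> \<open>The product formula is indexed by basis vectors, the characters by coordinates;
    \<open>idx\<close> inverts \<open>i \<mapsto> axis i 1\<close>.\<close>
  define idx :: "real ^ 'd \<Rightarrow> 'd" where "idx b = (THE i. b = axis i 1)" for b
  have idx: "idx (axis i 1) = i" for i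
    unfolding idx_def by (rule the_equality) (auto simp: axis_eq_axis)
  have Basis: "(Basis :: (real ^ 'd) set) = (\<lambda>i. axis i 1) ` UNIV"
    by (auto simp: Basis_vec_def)
  have inj: "inj (\<lambda>i::'d. axis i (1::real))"
    by (auto simp: inj_on_def axis_eq_axis)
  have "(\<integral>t. character k t * cnj (character l t) \<partial>torus_measure) =
      (\<integral>t. indicator torus t *\<^sub>R (character k t * cnj (character l t)) \<partial>lborel)"
    unfolding torus_measure_def by (rule integral_restrict_space) simp
  also have "\<dots> = (\<integral>t. (\<Prod>b\<in>Basis. g (idx b) (t \<bullet> b)) \<partial>lborel)"
  proof (rule Bochner_Integration.integral_cong[OF refl])
    fix t :: "real ^ 'd"
    have "character k t * cnj (character l t) =
        exp (\<Sum>i\<in>UNIV. \<i> * of_real (of_int (int (k $ i) - int (l $ i)) * t $ i))"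
      by (simp add: character_def lattice_dot_def exp_cnj sum_distrib_left sum_subtractf sum_negf algebra_simps
          flip: exp_add)
    also have "\<dots> = (\<Prod>i\<in>UNIV. exp (\<i> * of_real (of_int (int (k $ i) - int (l $ i)) * t $ i)))"
      by (simp add: exp_sum)
    finally have "indicator torus t *\<^sub>R (character k t * cnj (character l t)) = (\<Prod>i\<in>UNIV. g i (t $ i))"
      by (auto simp: g_def indicator_def torus_def)
    also have "\<dots> = (\<Prod>b\<in>Basis. g (idx b) (t \<bullet> b))"
      unfolding Basis by (simp add: prod.reindex[OF inj] idx inner_axis)
    finally show "indicator torus t *\<^sub>R (character k t * cnj (character l t)) = \<dots>" .
  qed
  also have "\<dots> = (\<Prod>b\<in>Basis. \<integral>s. g (idx b) s \<partial>lborel)"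
    unfolding g_def by (intro integral_lborel_prod integral_character_interval)
  also have "\<dots> = (\<Prod>i\<in>UNIV. \<integral>s. g i s \<partial>lborel)"
    unfolding Basis by (simp add: prod.reindex[OF inj] idx)
  also have "\<dots> = (\<Prod>i\<in>UNIV. if k $ i = l $ i then 2 * of_real pi else 0)"
    unfolding g_def integral_character_interval by (intro prod.cong) auto
  also have "\<dots> = (if k = l then (2 * of_real pi) ^ CARD('d) else 0)"
    by (auto simp: vec_eq_iff)
  finally show ?thesis .
qed

text \<open>Parseval's identity: in the expanded square only the diagonal survives integration. It
  supplies the hypothesis \<open>orth\<close> with \<open>C = (2 * pi) ^ CARD('d)\<close>.\<close>

lemma nn_integral_trigonometric_sum:
  fixes B :: "(nat ^ 'd) set" and x :: "nat ^ 'd \<Rightarrow> real"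
  assumes "finite B"
  shows "(\<integral>\<^sup>+t. ennreal ((cmod (\<Sum>k\<in>B. character k t * of_real (x k)))\<^sup>2) \<partial>torus_measure) =
    ennreal (\<Sum>k\<in>B. (2 * pi) ^ CARD('d) * (x k)\<^sup>2)"
proof -
  interpret finite_measure "torus_measure :: (real ^ 'd) measure"
    by (rule finite_measure_torus)
  have norm_char: "cmod (character k t) = 1" for k :: "nat ^ 'd" and t
    by (simp add: character_def)
  have int: "integrable torus_measure (\<lambda>t. character k t * cnj (character l t))" for k l :: "nat ^ 'd"
  proof (rule integrable_const_bound[of _ 1])
    have [measurable]: "cnj \<in> borel_measurable borel"
      by (intro borel_measurable_continuous_onI continuous_intros)
    show "(\<lambda>t. character k t * cnj (character l t)) \<in> borel_measurable torus_measure"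
      by measurable
  qed (simp add: norm_mult norm_char)
  let ?S = "\<lambda>t. \<Sum>k\<in>B. character k t * of_real (x k)"
  have eq: "of_real ((cmod (?S t))\<^sup>2) =
      (\<Sum>k\<in>B. \<Sum>l\<in>B. of_real (x k * x l) * (character k t * cnj (character l t)))" for t
    by (simp only: complex_norm_square) (simp add: sum_product algebra_simps)
  have integrable: "integrable torus_measure (\<lambda>t. complex_of_real ((cmod (?S t))\<^sup>2))"
    unfolding eq using int by (intro Bochner_Integration.integrable_sum integrable_mult_right)
  have "complex_of_real (\<integral>t. (cmod (?S t))\<^sup>2 \<partial>torus_measure) =
      (\<integral>t. of_real ((cmod (?S t))\<^sup>2) \<partial>torus_measure)"
    by (rule integral_complex_of_real[symmetric])
  also have "\<dots> = (\<Sum>k\<in>B. \<Sum>l\<in>B. of_real (x k * x l) * (if k = l then (2 * of_real pi) ^ CARD('d) else 0))"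
    unfolding eq using int
    by (simp add: Bochner_Integration.integral_sum integral_character del: of_real_mult)
  also have "\<dots> = (\<Sum>k\<in>B. of_real (x k * x k) * (2 * of_real pi) ^ CARD('d))"
    using assms by (intro sum.cong refl) (simp add: if_distrib sum.delta cong: if_cong)
  also have "\<dots> = of_real (\<Sum>k\<in>B. (2 * pi) ^ CARD('d) * (x k)\<^sup>2)"
    by (simp add: power2_eq_square mult_ac)
  finally have "(\<integral>t. (cmod (?S t))\<^sup>2 \<partial>torus_measure) = (\<Sum>k\<in>B. (2 * pi) ^ CARD('d) * (x k)\<^sup>2)"
    by (simp only: of_real_eq_iff)
  moreover have "integrable torus_measure (\<lambda>t. (cmod (?S t))\<^sup>2)"
    using integrable by (simp only: complex_of_real_integrable_eq)
  ultimately show ?thesis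
    by (subst nn_integral_eq_integral) auto
qed

section \<open>Geometric series and the moment bound\<close>

lemma suminf_ennreal_swap:
  fixes f :: "nat \<Rightarrow> nat \<Rightarrow> ennreal"
  shows "(\<Sum>m. \<Sum>i. f m i) = (\<Sum>i. \<Sum>m. f m i)"
proof -
  have "(\<Sum>m. \<Sum>i. f m i) = (\<integral>\<^sup>+m. (\<Sum>i. f m i) \<partial>count_space UNIV)"
    by (rule nn_integral_count_space_nat[symmetric])
  also have "\<dots> = (\<Sum>i. \<integral>\<^sup>+m. f m i \<partial>count_space UNIV)"
    by (rule nn_integral_suminf) simp
  finally show ?thesis by (simp add: nn_integral_count_space_nat)
qed

text \<open>For ratio at least 2, the powers before \<open>b ^ n\<close> sum to at most
  \<open>b ^ n\<close>. Hence the powers below \<open>z\<close> sum to at most twice the largest of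
  them.\<close>

lemma suminf_powers_below:
  fixes b z :: real
  assumes "2 \<le> b" and "0 \<le> z"
  shows "(\<Sum>m. ennreal (if b ^ m < z then b ^ m else 0)) \<le> ennreal (2 * z)"
proof (rule suminf_le_const[OF summableI])
  fix n
  have geom: "(\<Sum>m<n. b ^ m) \<le> b ^ n" for n
  proof (induction n)
    case (Suc n)
    then have "(\<Sum>m<Suc n. b ^ m) \<le> 2 * b ^ n" by simp
    also have "\<dots> \<le> b * b ^ n" using assms by (intro mult_right_mono) auto
    finally show ?case by simp
  qed simp
  have "(\<Sum>m<n. if b ^ m < z then b ^ m else 0) \<le> 2 * z"
  proof (induction n)
    case (Suc n)
    show ?case
    proof (cases "b ^ n < z")
      case True
      have "(\<Sum>m<Suc n. if b ^ m < z then b ^ m else 0) \<le> (\<Sum>m<n. b ^ m) + b ^ n"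
        using assms True by (auto intro!: sum_mono)
      also have "\<dots> \<le> 2 * z" using geom[of n] True by simp
      finally show ?thesis .
    qed (use Suc in simp)
  qed (use assms in simp)
  then show "(\<Sum>m<n. ennreal (if b ^ m < z then b ^ m else 0)) \<le> ennreal (2 * z)"
    using assms by (subst sum_ennreal) (auto intro!: ennreal_leI)
qed

text \<open>Ratio test: the polynomial contributes a ratio tending to 1, so eventually the quotient
  stays below the midpoint of \<rho> and 1. It is applied with
  \<open>\<rho> = 2 powr p / 4\<close>.\<close>

lemma summable_fourth_power_geometric:
  fixes \<rho> :: real
  assumes "0 < \<rho>" and "\<rho> < 1"
  shows "summable (\<lambda>i. (real i + 1) ^ 4 * \<rho> ^ i)"
proof -
  have "(\<lambda>i. ((real i + 2) / (real i + 1)) ^ 4 * \<rho>) \<longlonglongrightarrow> \<rho>"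
    using assms by real_asymp
  then have "\<forall>\<^sub>F i in sequentially. ((real i + 2) / (real i + 1)) ^ 4 * \<rho> < (1 + \<rho>) / 2"
    by (rule order_tendstoD) (use assms in simp)
  then obtain N where N: "\<And>i. N \<le> i \<Longrightarrow> ((real i + 2) / (real i + 1)) ^ 4 * \<rho> < (1 + \<rho>) / 2"
    by (auto simp: eventually_sequentially)
  show ?thesis
  proof (rule summable_ratio_test[of "(1 + \<rho>) / 2" N])
    fix i assume "N \<le> i"
    have "(real (Suc i) + 1) ^ 4 * \<rho> ^ Suc i =
        (((real i + 2) / (real i + 1)) ^ 4 * \<rho>) * ((real i + 1) ^ 4 * \<rho> ^ i)"
      by (simp add: power_divide add_ac)
    also have "\<dots> \<le> (1 + \<rho>) / 2 * ((real i + 1) ^ 4 * \<rho> ^ i)"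
      using N[OF \<open>N \<le> i\<close>] assms by (intro mult_right_mono) auto
    finally show "norm ((real (Suc i) + 1) ^ 4 * \<rho> ^ Suc i) \<le> (1 + \<rho>) / 2 * norm ((real i + 1) ^ 4 * \<rho> ^ i)"
      using assms by simp
  qed (use assms in simp)
qed

text \<open>
  The level \<open>b\<^sup>m\<^sup>/\<^sup>p / 2\<^sup>i\<close> is exceeded by \<open>Y\<close> only if \<open>b\<^sup>m < (2\<^sup>i \<bar>Y\<bar>)\<^sup>p\<close>, and these \<open>b\<^sup>m\<close> form a geometric
  progression.
\<close>

lemma (in prob_space) tail_sum_le_moment:
  fixes Y :: "'a \<Rightarrow> real" and b p :: real
  assumes [measurable]: "Y \<in> borel_measurable M" and b: "2 \<le> b" and p: "0 < p"
    and int: "integrable M (\<lambda>\<omega>. \<bar>Y \<omega>\<bar> powr p)"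
  shows "(\<Sum>m. ennreal (b ^ m * prob {\<omega> \<in> space M. (b ^ m) powr (1 / p) / 2 ^ i < \<bar>Y \<omega>\<bar>})) \<le>
    ennreal (2 * (2 powr p) ^ i * expectation (\<lambda>\<omega>. \<bar>Y \<omega>\<bar> powr p))"
proof -
  let ?E = "\<lambda>m. {\<omega> \<in> space M. (b ^ m) powr (1 / p) / 2 ^ i < \<bar>Y \<omega>\<bar>}"
  have "(\<Sum>m. ennreal (b ^ m * prob (?E m))) = (\<Sum>m. \<integral>\<^sup>+\<omega>. ennreal (b ^ m) * indicator (?E m) \<omega> \<partial>M)"
    using b by (intro suminf_cong) (simp add: nn_integral_cmult_indicator emeasure_eq_measure ennreal_mult)
  also have "\<dots> = (\<integral>\<^sup>+\<omega>. (\<Sum>m. ennreal (b ^ m) * indicator (?E m) \<omega>) \<partial>M)"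
    by (intro nn_integral_suminf[symmetric]) measurable
  also have "\<dots> \<le> (\<integral>\<^sup>+\<omega>. ennreal (2 * (2 powr p) ^ i * \<bar>Y \<omega>\<bar> powr p) \<partial>M)"
  proof (rule nn_integral_mono)
    fix \<omega>
    define z where "z = (2 powr p) ^ i * \<bar>Y \<omega>\<bar> powr p"
    have z: "(2 ^ i * \<bar>Y \<omega>\<bar>) powr p = z"
      by (simp add: z_def powr_mult powr_power flip: powr_realpow)
         (simp add: powr_powr mult.commute)
    have "b ^ m < z" if "(b ^ m) powr (1 / p) / 2 ^ i < \<bar>Y \<omega>\<bar>" for m
    proof -
      have "(b ^ m) powr (1 / p) < 2 ^ i * \<bar>Y \<omega>\<bar>"
        using that by (simp add: field_simps)
      then have "((b ^ m) powr (1 / p)) powr p < (2 ^ i * \<bar>Y \<omega>\<bar>) powr p"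
        using p by (intro powr_less_mono2) auto
      then show ?thesis
        using b p by (simp add: powr_powr z)
    qed
    then have "(\<Sum>m. ennreal (b ^ m) * indicator (?E m) \<omega>) \<le> (\<Sum>m. ennreal (if b ^ m < z then b ^ m else 0))"
      by (intro suminf_le summableI) (auto simp: indicator_def)
    also have "\<dots> \<le> ennreal (2 * z)"
      by (rule suminf_powers_below[OF b]) (simp add: z_def)
    finally show "(\<Sum>m. ennreal (b ^ m) * indicator (?E m) \<omega>) \<le> ennreal (2 * (2 powr p) ^ i * \<bar>Y \<omega>\<bar> powr p)"
      by (simp add: z_def mult.assoc)
  qed
  also have "\<dots> = ennreal (2 * (2 powr p) ^ i * expectation (\<lambda>\<omega>. \<bar>Y \<omega>\<bar> powr p))"
    using int by (subst nn_integral_eq_integral) auto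
  finally show ?thesis .
qed

section \<open>Lattice cubes and the random level counts\<close>

text \<open>Cubes become sublevel sets of the maximal coordinate, so the summation over cubes fits
  the linear ordering of the maximal inequality.\<close>

lemma Max_range_le_iff: "Max (range (\<lambda>i. k $ i)) \<le> n \<longleftrightarrow> k \<le> vec n" for k :: "nat ^ 'd"
  by (simp add: less_eq_vec_def)

lemma finite_lattice_box: "finite {k :: nat ^ 'd. k \<le> vec n}"
proof -
  have "vec_nth ` {k :: nat ^ 'd. k \<le> vec n} \<subseteq> (PiE (UNIV :: 'd set) (\<lambda>_. {..n}))"
    by (auto simp: less_eq_vec_def)
  then have "finite (vec_nth ` {k :: nat ^ 'd. k \<le> vec n})"
    by (rule finite_subset) (intro finite_PiE, auto)
  then show ?thesis
    by (rule finite_imageD) (auto simp: inj_on_def vec_nth_inject)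
qed

lemma lattice_vol_vec: "lattice_vol (vec n :: nat ^ 'd) = n ^ CARD('d)"
  by (simp add: lattice_vol_def)

lemma vec_in_pos_lattice: "0 < n \<Longrightarrow> vec n \<in> pos_lattice"
  by (simp add: pos_lattice_def)

text \<open>The series has finite expectation. Domination on the cube of side \<open>2 ^ m\<close>
  replaces expected counts by tails of \<open>Y\<close>; their sum over m costs (2^p)^i by the
  moment bound, which the weight 4^(-i) absorbs.\<close>

lemma AE_level_counts_summable:
  fixes P :: "'a measure"
    and X :: "nat ^ 'd \<Rightarrow> 'a \<Rightarrow> real"
    and Y :: "'a \<Rightarrow> real"
    and M p :: real
  defines "J \<equiv> \<lambda>m. {k \<in> pos_lattice. k \<le> vec (2 ^ m)}"
  assumes "prob_space P"
    and Y[measurable]: "Y \<in> borel_measurable P"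
    and X: "\<And>n. n \<in> pos_lattice \<Longrightarrow> X n \<in> borel_measurable P"
    and M: "0 < M"
    and dom: "\<And>x n. 0 \<le> x \<Longrightarrow> n \<in> pos_lattice \<Longrightarrow>
           1 / real (lattice_vol n) *
             (\<Sum>k\<in>{k \<in> pos_lattice. k \<le> n}. measure P {\<omega> \<in> space P. \<bar>X k \<omega>\<bar> > x})
           \<le> M * measure P {\<omega> \<in> space P. \<bar>Y \<omega>\<bar> > x}"
    and p: "1 < p" "p < 2"
    and int: "integrable P (\<lambda>\<omega>. \<bar>Y \<omega>\<bar> powr p)"
  shows "AE \<omega> in P. (\<Sum>m. \<Sum>i. ennreal ((real i + 1) ^ 4 / 4 ^ i *
      real (card {k\<in>J m. (2 ^ m) powr (CARD('d) / p) / 2 ^ i < \<bar>X k \<omega>\<bar>}))) \<noteq> \<infinity>"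
proof -
  interpret prob_space P by fact
  let ?w = "\<lambda>i. (real i + 1) ^ 4 / 4 ^ i"
  \<comment> \<open>\<open>b ^ m\<close> is the volume of the cube of side \<open>2 ^ m\<close>.
    Written with \<open>b\<close>, the thresholds fit \<open>tail_sum_le_moment\<close>; fact
    \<open>a\<close> rewrites them for the convergence lemma with q = d / p.\<close>
  define b :: real where "b = 2 ^ CARD('d)"
  have b: "2 \<le> b" unfolding b_def using power_increasing[of 1 "CARD('d)" "2::real"] by simp
  define a where "a m i = (b ^ m) powr (1 / p) / 2 ^ i" for m i
  have a: "a m i = (2 ^ m) powr (CARD('d) / p) / 2 ^ i" for m i
  proof -
    have "b ^ m = (2 ^ m) powr real CARD('d)"
      by (simp add: b_def powr_realpow mult.commute flip: power_mult)
    then show ?thesis by (simp add: a_def powr_powr)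
  qed
  have a_nonneg: "0 \<le> a m i" for m i by (simp add: a_def)
  have fin: "finite (J m)" for m
    unfolding J_def using finite_lattice_box by (rule finite_subset[rotated]) auto
  define S where "S m i \<omega> = ennreal (?w i * real (card {k\<in>J m. a m i < \<bar>X k \<omega>\<bar>}))" for m i \<omega>
  have X_meas[measurable]: "X k \<in> borel_measurable P" if "k \<in> J m" for k m
    using that X by (auto simp: J_def)
  have S: "S m i \<omega> = ennreal (?w i) * (\<Sum>k\<in>J m. indicator {\<omega> \<in> space P. a m i < \<bar>X k \<omega>\<bar>} \<omega>)"
    if "\<omega> \<in> space P" for m i \<omega>
  proof -
    have "(\<Sum>k\<in>J m. indicator {\<omega> \<in> space P. a m i < \<bar>X k \<omega>\<bar>} \<omega>) =
        (\<Sum>k\<in>J m. if a m i < \<bar>X k \<omega>\<bar> then 1 else 0 :: ennreal)"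
      using that by (intro sum.cong) (auto simp: indicator_def)
    also have "\<dots> = (\<Sum>k\<in>{k\<in>J m. a m i < \<bar>X k \<omega>\<bar>}. 1)"
      by (rule sum.inter_filter[symmetric, OF fin])
    also have "\<dots> = ennreal (real (card {k\<in>J m. a m i < \<bar>X k \<omega>\<bar>}))"
      by (simp add: ennreal_of_nat_eq_real_of_nat)
    finally have "(\<Sum>k\<in>J m. indicator {\<omega> \<in> space P. a m i < \<bar>X k \<omega>\<bar>} \<omega>) =
        ennreal (real (card {k\<in>J m. a m i < \<bar>X k \<omega>\<bar>}))" .
    then show ?thesis
      unfolding S_def by (subst ennreal_mult) simp_all
  qed
  have S_meas[measurable]: "S m i \<in> borel_measurable P" for m i
    by (subst measurable_cong[OF S]) measurable
  define E where "E = expectation (\<lambda>\<omega>. \<bar>Y \<omega>\<bar> powr p)"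
  have E: "0 \<le> E" by (simp add: E_def)
  have S_int: "(\<integral>\<^sup>+\<omega>. S m i \<omega> \<partial>P) \<le>
      ennreal (?w i * M) * ennreal (b ^ m * prob {\<omega> \<in> space P. a m i < \<bar>Y \<omega>\<bar>})" for m i
  proof -
    have "(\<integral>\<^sup>+\<omega>. S m i \<omega> \<partial>P) =
        (\<integral>\<^sup>+\<omega>. ennreal (?w i) * (\<Sum>k\<in>J m. indicator {\<omega> \<in> space P. a m i < \<bar>X k \<omega>\<bar>} \<omega>) \<partial>P)"
      by (rule nn_integral_cong) (rule S)
    also have "\<dots> = ennreal (?w i) * (\<Sum>k\<in>J m. emeasure P {\<omega> \<in> space P. a m i < \<bar>X k \<omega>\<bar>})"
      by (subst nn_integral_cmult, measurable) (subst nn_integral_sum, auto intro!: sum.cong)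
    also have "\<dots> = ennreal (?w i * (\<Sum>k\<in>J m. prob {\<omega> \<in> space P. a m i < \<bar>X k \<omega>\<bar>}))"
      by (subst ennreal_mult) (simp_all add: emeasure_eq_measure sum_nonneg)
    also have "\<dots> \<le> ennreal (?w i * (M * (b ^ m * prob {\<omega> \<in> space P. a m i < \<bar>Y \<omega>\<bar>})))"
    proof (intro ennreal_leI mult_left_mono)
      have "real (lattice_vol (vec (2 ^ m) :: nat ^ 'd)) = b ^ m"
        by (simp add: lattice_vol_vec b_def mult.commute flip: power_mult)
      then show "(\<Sum>k\<in>J m. prob {\<omega> \<in> space P. a m i < \<bar>X k \<omega>\<bar>}) \<le>
          M * (b ^ m * prob {\<omega> \<in> space P. a m i < \<bar>Y \<omega>\<bar>})"
        using dom[OF a_nonneg vec_in_pos_lattice, of "2 ^ m" m i] b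
        by (simp add: J_def field_simps)
    qed simp
    also have "\<dots> = ennreal (?w i * M) * ennreal (b ^ m * prob {\<omega> \<in> space P. a m i < \<bar>Y \<omega>\<bar>})"
      using M b by (subst ennreal_mult[symmetric]) (auto simp: mult.assoc)
    finally show ?thesis .
  qed
  have "(\<integral>\<^sup>+\<omega>. (\<Sum>m. \<Sum>i. S m i \<omega>) \<partial>P) = (\<Sum>m. \<Sum>i. \<integral>\<^sup>+\<omega>. S m i \<omega> \<partial>P)"
    by (simp add: nn_integral_suminf)
  also have "\<dots> \<le> (\<Sum>m. \<Sum>i. ennreal (?w i * M) * ennreal (b ^ m * prob {\<omega> \<in> space P. a m i < \<bar>Y \<omega>\<bar>}))"
    by (intro suminf_le summableI S_int)
  \<comment> \<open>The moment bound sums over m at a fixed depth i, so the order of summation is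
    exchanged first.\<close>
  also have "\<dots> = (\<Sum>i. ennreal (?w i * M) * (\<Sum>m. ennreal (b ^ m * prob {\<omega> \<in> space P. a m i < \<bar>Y \<omega>\<bar>})))"
    by (subst suminf_ennreal_swap) simp
  also have "\<dots> \<le> (\<Sum>i. ennreal (?w i * M) * ennreal (2 * (2 powr p) ^ i * E))"
    unfolding a_def E_def using p int
    by (intro suminf_le summableI mult_left_mono tail_sum_le_moment b Y) auto
  also have "\<dots> = (\<Sum>i. ennreal (2 * M * E) * ennreal ((real i + 1) ^ 4 * (2 powr p / 4) ^ i))"
    using M E by (intro suminf_cong) (simp add: power_divide field_simps flip: ennreal_mult)
  also have "\<dots> = ennreal (2 * M * E) * (\<Sum>i. ennreal ((real i + 1) ^ 4 * (2 powr p / 4) ^ i))"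
    by (rule ennreal_suminf_cmult)
  also have "\<dots> < \<infinity>"
  proof -
    \<comment> \<open>Here p < 2 enters: the ratio 2^p / 4 is below 1.\<close>
    have "(2::real) powr p < 2 powr 2" using p by (intro powr_less_mono) auto
    then have "summable (\<lambda>i. (real i + 1) ^ 4 * (2 powr p / 4) ^ i)"
      by (intro summable_fourth_power_geometric) auto
    then have "(\<Sum>i. ennreal ((real i + 1) ^ 4 * (2 powr p / 4) ^ i)) \<noteq> top"
      by (intro ennreal_suminf_neq_top) auto
    then show ?thesis by (simp add: ennreal_mult_less_top less_top)
  qed
  finally have "(\<integral>\<^sup>+\<omega>. (\<Sum>m. \<Sum>i. S m i \<omega>) \<partial>P) \<noteq> \<infinity>"
    by simp
  then have "AE \<omega> in P. (\<Sum>m. \<Sum>i. S m i \<omega>) \<noteq> \<infinity>"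
    by (intro nn_integral_PInf_AE) measurable
  then show ?thesis by (simp only: S_def a)
qed

section \<open>Exchange of the almost-everywhere quantifiers and passage to the completion\<close>

theorem mainTheorem5:
  fixes P :: "'a measure"
    and X :: "nat ^ 'd \<Rightarrow> 'a \<Rightarrow> real"
    and Y :: "'a \<Rightarrow> real"
    and M p :: real
  assumes "prob_space P"
    and "Y \<in> borel_measurable P"
    and "\<And>n. n \<in> pos_lattice \<Longrightarrow> X n \<in> borel_measurable P"
    and "0 < M"
    and "\<And>x n. 0 \<le> x \<Longrightarrow> n \<in> pos_lattice \<Longrightarrow>
           1 / real (lattice_vol n) *
             (\<Sum>k\<in>{k \<in> pos_lattice. k \<le> n}. measure P {\<omega> \<in> space P. \<bar>X k \<omega>\<bar> > x})
           \<le> M * measure P {\<omega> \<in> space P. \<bar>Y \<omega>\<bar> > x}"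
    and "1 < p" and "p < 2"
    and "integrable P (\<lambda>\<omega>. \<bar>Y \<omega>\<bar> powr p)"
  shows "AE t in lebesgue_on torus. AE \<omega> in P.
           (\<lambda>n. dft X (vec n) t \<omega> / of_real (real (lattice_vol (vec n :: nat ^ 'd)) powr (1 / p)))
             \<longlonglongrightarrow> 0"
proof -
  interpret prob_space P by fact
  interpret T: finite_measure "torus_measure :: (real ^ 'd) measure"
    by (rule finite_measure_torus)
  interpret pair_sigma_finite P "torus_measure :: (real ^ 'd) measure" ..
  \<comment> \<open>Taking the modulus keeps the meaning of convergence to 0 and makes it a
    condition on real sequences, whose joint measurability in \<omega> and t is shown below.\<close>
  define Q where "Q \<omega> t \<longleftrightarrow>
    (\<lambda>n. cmod (dft X (vec n) t \<omega> / of_real (real (lattice_vol (vec n :: nat ^ 'd)) powr (1 / p)))) \<longlonglongrightarrow> 0"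
    for \<omega> t
  define h where "h k = Max (range (\<lambda>i. k $ i))" for k :: "nat ^ 'd"
  have h: "h k \<le> n \<longleftrightarrow> k \<le> vec n" for k n
    unfolding h_def by (rule Max_range_le_iff)
  have level_counts: "AE \<omega> in P. (\<Sum>m. \<Sum>i. ennreal ((real i + 1) ^ 4 / 4 ^ i *
      real (card {k\<in>{k \<in> pos_lattice. k \<le> vec (2 ^ m)}. (2 ^ m) powr (CARD('d) / p) / 2 ^ i < \<bar>X k \<omega>\<bar>}))) \<noteq> \<infinity>"
    by (rule AE_level_counts_summable) (fact assms)+
  have "AE \<omega> in P. AE t in torus_measure. Q \<omega> t"
    using level_counts
  proof eventually_elim
    fix \<omega>
    assume total: "(\<Sum>m. \<Sum>i. ennreal ((real i + 1) ^ 4 / 4 ^ i *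
      real (card {k\<in>{k \<in> pos_lattice. k \<le> vec (2 ^ m)}. (2 ^ m) powr (CARD('d) / p) / 2 ^ i < \<bar>X k \<omega>\<bar>}))) \<noteq> \<infinity>"
    have "AE t in torus_measure. (\<lambda>n. (\<Sum>k\<in>{k\<in>pos_lattice. h k \<le> n}. character k t * of_real (X k \<omega>)) /
        of_real (real n powr (CARD('d) / p))) \<longlonglongrightarrow> 0"
    proof (rule AE_partial_sums_tendsto_zero)
      show "finite {k\<in>pos_lattice. h k \<le> n}" for n
        unfolding h using finite_lattice_box by (rule finite_subset[rotated]) auto
      show "0 \<le> (2 * pi) ^ CARD('d)" by simp
      show "(\<integral>\<^sup>+t. ennreal ((cmod (\<Sum>k\<in>B. character k t * of_real (X k \<omega>)))\<^sup>2) \<partial>torus_measure)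
          \<le> ennreal (\<Sum>k\<in>B. (2 * pi) ^ CARD('d) * (X k \<omega>)\<^sup>2)" if "finite B" for B :: "(nat ^ 'd) set"
        by (simp only: nn_integral_trigonometric_sum[OF that] order_refl)
      show "(\<Sum>m. \<Sum>i. ennreal ((real i + 1) ^ 4 / 4 ^ i * real (card {k\<in>{k\<in>pos_lattice. h k \<le> 2 ^ m}.
          (2 ^ m) powr (CARD('d) / p) / 2 ^ i < \<bar>X k \<omega>\<bar>}))) < \<infinity>"
        using total unfolding h by (simp add: less_top)
    qed (use assms in auto)
    then show "AE t in torus_measure. Q \<omega> t"
    proof (rule AE_mp, intro AE_I2 impI)
      fix t :: "real ^ 'd"
      \<comment> \<open>At n = 0 both sides vanish: the dimension is positive and
        \<open>0 powr y = 0\<close>.\<close>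
      have norm: "real (lattice_vol (vec n :: nat ^ 'd)) powr (1 / p) = real n powr (CARD('d) / p)" for n
        unfolding lattice_vol_vec
        by (cases "n = 0") (simp_all add: powr_powr power_0_left flip: powr_realpow)
      assume "(\<lambda>n. (\<Sum>k\<in>{k\<in>pos_lattice. h k \<le> n}. character k t * of_real (X k \<omega>)) /
        of_real (real n powr (CARD('d) / p))) \<longlonglongrightarrow> 0"
      then show "Q \<omega> t"
        unfolding Q_def norm h dft_def character_def by (rule tendsto_norm_zero)
    qed
  qed
  \<comment> \<open>The exceptional set of t was found separately for each \<omega>. Joint
    measurability lets Fubini's theorem turn this into an exceptional set of \<omega> for almost
    each t.\<close>
  moreover have "Measurable.pred (P \<Otimes>\<^sub>M torus_measure) (\<lambda>z. Q (fst z) (snd z))"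
  proof -
    have "(\<lambda>z. dft X n (snd z) (fst z)) \<in> borel_measurable (P \<Otimes>\<^sub>M torus_measure)" for n
    proof -
      have "(\<lambda>z. character k (snd z) * of_real (X k (fst z))) \<in> borel_measurable (P \<Otimes>\<^sub>M torus_measure)"
        if "k \<in> pos_lattice" for k
      proof -
        have [measurable]: "X k \<in> borel_measurable P" using assms that by blast
        show ?thesis by measurable
      qed
      then show ?thesis
        unfolding dft_def character_def[symmetric] by (intro borel_measurable_sum) simp
    qed
    then have [measurable]: "(\<lambda>z. dft X (vec n) (snd z) (fst z)) \<in> borel_measurable (P \<Otimes>\<^sub>M torus_measure)" for n
      by blast
    show ?thesis unfolding Q_def by measurable
  qed
  ultimately have "AE t in torus_measure. AE \<omega> in P. Q \<omega> t"
    by (subst (asm) AE_commute) (auto simp: pred_def)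
  then have "AE t in lborel. t \<in> torus \<longrightarrow> (AE \<omega> in P. Q \<omega> t)"
    unfolding torus_measure_def by (subst (asm) AE_restrict_space_iff) auto
  \<comment> \<open>Null sets of the Borel measure remain null in its completion, which is the
    measure of the statement.\<close>
  then have "AE t in lebesgue. t \<in> torus \<longrightarrow> (AE \<omega> in P. Q \<omega> t)"
    by (rule AE_completion)
  then have "AE t in lebesgue_on torus. AE \<omega> in P. Q \<omega> t"
    by (subst AE_restrict_space_iff) auto
  then show ?thesis
    unfolding Q_def by (simp only: tendsto_norm_zero_iff)
qed

end
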